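(* Let $G$ be a finite graph with vertex set $V$ and edge set $E$ that contains no cycle of length $3$ and no cycle of length $4$ (as subgraphs). Then the main diagonal of the magnitude homology of $G$ is torsion-free and satisfies $\mathrm{MH}_{0,0}(G)\cong\mathbb{Z}^{|V|}$ and $\mathrm{MH}_{k,k}(G)\cong\mathbb{Z}^{2|E|}$ for all $k>0$.
   Context: Graphs are finite, undirected, with no loops and no multiple edges. For a graph $G$, $d(x,y)$ denotes the shortest-path distance (edges have length $1$; $\infty$ if no path). A $k$-path is a tuple $(x_0,\dots,x_k)$ of vertices with $x_i\neq x_{i+1}$ and $d(x_i,x_{i+1})<\infty$; its length is $\sum_i d(x_i,x_{i+1})$. $\mathrm{MC}_{k,\ell}(G)$ is the free abelian group on $k$-paths of length $\ell$, with differential $\partial=\sum_{i=1}^{k-1}(-1)^i\partial_i$, where $\partial_i$ deletes $x_i$ if the resulting tuple is a $(k-1)$-path of the same length $\ell$ and is $0$ otherwise; $\mathrm{MH}_{k,\ell}(G)=H_k(\mathrm{MC}_{*,\ell}(G))$. The main diagonal is the sequence of groups $\mathrm{MH}_{k,k}(G)$, $k\ge 0$. *)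

theory Defs
  imports "HOL-Algebra.Free_Abelian_Groups" "HOL-Library.Extended_Nat"
begin

text \<open>A finite simple graph is given by its vertex set \<open>V\<close> and its set \<open>E\<close> of edges, each edge
  being a two-element set of vertices.\<close>

definition simple_graph :: "'a set \<Rightarrow> 'a set set \<Rightarrow> bool" where
  "simple_graph V E \<longleftrightarrow> finite V \<and> (\<forall>e\<in>E. e \<subseteq> V \<and> card e = 2)"

text \<open>A cycle of length \<open>n\<close> as a (not necessarily induced) subgraph; meaningful for \<open>n \<ge> 3\<close>.\<close>

definition has_cycle :: "'a set set \<Rightarrow> nat \<Rightarrow> bool" where
  "has_cycle E n \<longleftrightarrow>
     (\<exists>c. length c = n \<and> distinct c \<and> (\<forall>i<n. {c ! i, c ! (Suc i mod n)} \<in> E))"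

definition graph_path :: "'a set \<Rightarrow> 'a set set \<Rightarrow> 'a \<Rightarrow> 'a \<Rightarrow> 'a list \<Rightarrow> bool" where
  "graph_path V E x y p \<longleftrightarrow>
     p \<noteq> [] \<and> hd p = x \<and> last p = y \<and> set p \<subseteq> V \<and> distinct p \<and>
     successively (\<lambda>u v. {u, v} \<in> E) p"

text \<open>The infimum over the empty set in \<^typ>\<open>enat\<close> is \<open>\<infinity>\<close>.\<close>

definition graph_dist :: "'a set \<Rightarrow> 'a set set \<Rightarrow> 'a \<Rightarrow> 'a \<Rightarrow> enat" where
  "graph_dist V E x y = (INF p\<in>{p. graph_path V E x y p}. enat (length p - 1))"

text \<open>The tuple \<open>(x\<^sub>0, \<dots>, x\<^sub>k)\<close> is represented by a list of length \<open>k + 1\<close>.\<close>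

definition k_path :: "'a set \<Rightarrow> 'a set set \<Rightarrow> nat \<Rightarrow> 'a list \<Rightarrow> bool" where
  "k_path V E k xs \<longleftrightarrow>
     length xs = Suc k \<and> set xs \<subseteq> V \<and>
     (\<forall>i<k. xs ! i \<noteq> xs ! Suc i \<and> graph_dist V E (xs ! i) (xs ! Suc i) < \<infinity>)"

definition k_path_length :: "'a set \<Rightarrow> 'a set set \<Rightarrow> 'a list \<Rightarrow> enat" where
  "k_path_length V E xs = (\<Sum>i<length xs - 1. graph_dist V E (xs ! i) (xs ! Suc i))"

definition k_paths :: "'a set \<Rightarrow> 'a set set \<Rightarrow> nat \<Rightarrow> nat \<Rightarrow> 'a list set" where
  "k_paths V E k l = {xs. k_path V E k xs \<and> k_path_length V E xs = enat l}"

definition MC :: "'a set \<Rightarrow> 'a set set \<Rightarrow> nat \<Rightarrow> nat \<Rightarrow> ('a list \<Rightarrow>\<^sub>0 int) monoid" where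
  "MC V E k l = free_Abelian_group (k_paths V E k l)"

definition delete_nth :: "nat \<Rightarrow> 'a list \<Rightarrow> 'a list" where
  "delete_nth i xs = take i xs @ drop (Suc i) xs"

definition MC_face ::
    "'a set \<Rightarrow> 'a set set \<Rightarrow> nat \<Rightarrow> nat \<Rightarrow> nat \<Rightarrow> 'a list \<Rightarrow> ('a list \<Rightarrow>\<^sub>0 int)" where
  "MC_face V E k l i xs =
     (if delete_nth i xs \<in> k_paths V E (k - 1) l then frag_of (delete_nth i xs) else 0)"

text \<open>The differential from degree \<open>k\<close> to degree \<open>k - 1\<close>. For \<open>k = 0\<close> the sum is empty, so
  truncated subtraction does no harm: the differential out of degree \<open>0\<close> is zero.\<close>

definition MC_diff ::
    "'a set \<Rightarrow> 'a set set \<Rightarrow> nat \<Rightarrow> nat \<Rightarrow> ('a list \<Rightarrow>\<^sub>0 int) \<Rightarrow> ('a list \<Rightarrow>\<^sub>0 int)" where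
  "MC_diff V E k l =
     frag_extend (\<lambda>xs. \<Sum>i = 1..k - 1. frag_cmul ((- 1) ^ i) (MC_face V E k l i xs))"

definition MH :: "'a set \<Rightarrow> 'a set set \<Rightarrow> nat \<Rightarrow> nat \<Rightarrow> ('a list \<Rightarrow>\<^sub>0 int) set monoid" where
  "MH V E k l =
     subgroup_generated (MC V E k l) (kernel (MC V E k l) (MC V E (k - 1) l) (MC_diff V E k l))
       Mod (MC_diff V E (Suc k) l ` carrier (MC V E (Suc k) l))"

definition torsion_free_group :: "('a, 'b) monoid_scheme \<Rightarrow> bool" where
  "torsion_free_group G \<longleftrightarrow>
     (\<forall>x\<in>carrier G. \<forall>n::nat. n > 0 \<longrightarrow> x [^]\<^bsub>G\<^esub> n = \<one>\<^bsub>G\<^esub> \<longrightarrow> x = \<one>\<^bsub>G\<^esub>)"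

definition integer_power_group :: "nat \<Rightarrow> (nat \<Rightarrow> int) monoid" where
  "integer_power_group n = product_group {..<n} (\<lambda>_. integer_group)"

end

theory Submission
  imports Defs
begin

text \<open>Steps of a \<open>k\<close>-path have length at least 1, so there are no \<open>(k + 1)\<close>-paths of length \<open>k\<close>, and
  \<open>k\<close>-paths of length \<open>k\<close> are walks along edges. Hence the diagonal group is the kernel of the
  differential. Without 3-cycles, deleting \<open>x\<^sub>i\<close> from a walk is non-zero in the complex iff
  \<open>x\<^sub>i\<^sub>-\<^sub>1 \<noteq> x\<^sub>i\<^sub>+\<^sub>1\<close>; the result has exactly one step of length 2, which determines \<open>i\<close>, and without
  4-cycles the deleted vertex is the unique common neighbour of the end points of that step. So the
  non-zero faces of all walks are pairwise distinct basis elements, and the kernel is freely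
  generated by the walks with no non-zero face: the vertices if \<open>k = 0\<close>, and otherwise the
  alternating walks, one for each oriented edge.\<close>

section \<open>Distances in a simple graph\<close>

lemma simple_graph_edge:
  assumes "simple_graph V E" "{u, v} \<in> E"
  shows "u \<noteq> v" "u \<in> V" "v \<in> V"
  using assms unfolding simple_graph_def by fastforce+

lemma graph_dist_le:
  assumes "graph_path V E u v p"
  shows "graph_dist V E u v \<le> enat (length p - 1)"
  unfolding graph_dist_def using assms by (intro INF_lower) auto

lemma graph_dist_ge_1:
  assumes "u \<noteq> v"
  shows "1 \<le> graph_dist V E u v"
  unfolding graph_dist_def
proof (rule INF_greatest)
  fix p assume "p \<in> {p. graph_path V E u v p}"
  then have p: "p \<noteq> []" "hd p = u" "last p = v"
    by (auto simp: graph_path_def)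
  with assms have "length p \<ge> 2"
    by (cases p; cases "tl p") auto
  then show "1 \<le> enat (length p - 1)"
    by (simp add: one_enat_def)
qed

text \<open>A non-empty set of \<open>enat\<close> values contains its infimum. Only the empty set
  has infimum \<infinity>, and a finite distance excludes that case.\<close>

lemma graph_dist_attained:
  assumes "graph_dist V E u v = enat n"
  obtains p where "graph_path V E u v p" "length p - 1 = n"
proof -
  let ?A = "(\<lambda>p. enat (length p - 1)) ` {p. graph_path V E u v p}"
  have "Inf ?A = enat n"
    using assms by (simp add: graph_dist_def)
  then have "enat n \<in> ?A"
    unfolding Inf_enat_def by (metis (no_types, lifting) LeastI_ex all_not_in_conv enat.distinct(1))
  then show ?thesis
    using that by auto
qed

lemma graph_dist_eq_1_iff:
  assumes "simple_graph V E"
  shows "graph_dist V E u v = 1 \<longleftrightarrow> {u, v} \<in> E"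
proof
  assume "graph_dist V E u v = 1"
  then obtain p where p: "graph_path V E u v p" "length p - 1 = 1"
    using graph_dist_attained by (metis one_enat_def)
  then obtain a b where "p = [a, b]"
    by (metis (no_types, lifting) One_nat_def Suc_1 diff_0_eq_0 diff_Suc_1 length_0_conv
        length_Suc_conv not0_implies_Suc zero_neq_one)
  with p show "{u, v} \<in> E"
    by (auto simp: graph_path_def)
next
  assume e: "{u, v} \<in> E"
  with assms have "graph_path V E u v [u, v]"
    using simple_graph_edge[OF assms e] by (auto simp: graph_path_def)
  from graph_dist_le[OF this] have "graph_dist V E u v \<le> 1"
    by (simp add: one_enat_def)
  with graph_dist_ge_1 simple_graph_edge(1)[OF assms e] show "graph_dist V E u v = 1"
    by (metis antisym)
qed

text \<open>The path through \<open>w\<close> bounds the distance by 2. Distance 0 is excluded by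
  distinctness of the end points, distance 1 by the missing edge.\<close>

lemma graph_dist_eq_2:
  assumes "simple_graph V E" "{u, w} \<in> E" "{w, v} \<in> E" "u \<noteq> v" "{u, v} \<notin> E"
  shows "graph_dist V E u v = 2"
proof -
  have "graph_path V E u v [u, w, v]"
    using assms simple_graph_edge[OF assms(1,2)] simple_graph_edge[OF assms(1,3)]
    by (auto simp: graph_path_def)
  from graph_dist_le[OF this] have le: "graph_dist V E u v \<le> 2"
    by (simp add: numeral_eq_enat eval_nat_numeral)
  have "1 < graph_dist V E u v"
    using graph_dist_ge_1[OF assms(4)] graph_dist_eq_1_iff[OF assms(1)] assms(5)
    by (metis order_le_less)
  with le show ?thesis
    by (cases "graph_dist V E u v") (auto simp: numeral_eq_enat one_enat_def)
qed

section \<open>Paths on the diagonal\<close>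

definition walks :: "'a set \<Rightarrow> 'a set set \<Rightarrow> nat \<Rightarrow> 'a list set" where
  "walks V E k =
     {xs. length xs = Suc k \<and> set xs \<subseteq> V \<and> (\<forall>i<k. {xs ! i, xs ! Suc i} \<in> E)}"

text \<open>Moves the step lengths from \<open>enat\<close> to \<open>nat\<close>, where addition is
  cancellative and the total can be compared with the number of steps.\<close>

lemma k_paths_step_lengths:
  assumes "xs \<in> k_paths V E k l"
  obtains n where "\<And>i. i < k \<Longrightarrow> graph_dist V E (xs ! i) (xs ! Suc i) = enat (n i)"
    "\<And>i. i < k \<Longrightarrow> 1 \<le> n i" "(\<Sum>i<k. n i) = l"
proof
  let ?d = "\<lambda>i. graph_dist V E (xs ! i) (xs ! Suc i)"
  define n where "n = (\<lambda>i. the_enat (?d i))"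
  have len: "length xs = Suc k"
    and fin: "\<And>i. i < k \<Longrightarrow> xs ! i \<noteq> xs ! Suc i \<and> ?d i < \<infinity>"
    and l: "(\<Sum>i<k. ?d i) = enat l"
    using assms by (auto simp: k_paths_def k_path_def k_path_length_def)
  show n: "?d i = enat (n i)" if "i < k" for i
    using fin[OF that] by (auto simp: n_def)
  show "1 \<le> n i" if "i < k" for i
    using graph_dist_ge_1[of "xs ! i" "xs ! Suc i" V E] fin[OF that] n[OF that]
    by (simp add: one_enat_def)
  have "of_nat (\<Sum>i<k. n i) = (\<Sum>i<k. ?d i)"
    unfolding of_nat_sum using n by (intro sum.cong) (auto simp: of_nat_eq_enat)
  with l show "(\<Sum>i<k. n i) = l"
    by (simp add: of_nat_eq_enat)
qed

lemma k_paths_diagonal: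
  assumes "simple_graph V E"
  shows "k_paths V E k k = walks V E k"
proof (intro equalityI subsetI)
  fix xs assume xs: "xs \<in> k_paths V E k k"
  then obtain n where n: "\<And>i. i < k \<Longrightarrow> graph_dist V E (xs ! i) (xs ! Suc i) = enat (n i)"
    "\<And>i. i < k \<Longrightarrow> 1 \<le> n i" "(\<Sum>i<k. n i) = k"
    using k_paths_step_lengths by blast
  \<comment> \<open>Termwise 1 \<le> \<open>n i\<close>, and both families sum to \<open>k\<close>
    over \<open>k\<close> indices, so equality holds in every term.\<close>
  have "1 = n i" if "i < k" for i
    by (rule sum_mono_inv[where I = "{..<k}"]) (use n that in auto)
  then have "{xs ! i, xs ! Suc i} \<in> E" if "i < k" for i
    using n(1) that graph_dist_eq_1_iff[OF assms] by (metis one_enat_def)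
  with xs show "xs \<in> walks V E k"
    by (auto simp: walks_def k_paths_def k_path_def)
next
  fix xs assume xs: "xs \<in> walks V E k"
  then have d: "graph_dist V E (xs ! i) (xs ! Suc i) = 1" "xs ! i \<noteq> xs ! Suc i" if "i < k" for i
    using that graph_dist_eq_1_iff[OF assms] simple_graph_edge(1)[OF assms]
    by (auto simp: walks_def)
  with xs show "xs \<in> k_paths V E k k"
    by (auto simp: walks_def k_paths_def k_path_def k_path_length_def of_nat_eq_enat one_enat_def)
qed

text \<open>This makes the group of boundaries in the diagonal degree trivial.\<close>

lemma k_paths_above_diagonal: "k_paths V E (Suc k) k = {}"
proof (rule equals0I)
  fix xs assume "xs \<in> k_paths V E (Suc k) k"
  then obtain n where n: "\<And>i. i < Suc k \<Longrightarrow> 1 \<le> n i" "(\<Sum>i<Suc k. n i) = k"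
    using k_paths_step_lengths by metis
  have "(\<Sum>i<Suc k. 1) \<le> (\<Sum>i<Suc k. n i)"
    using n(1) by (intro sum_mono) auto
  with n(2) show False by simp
qed

section \<open>Faces of walks under deletion of an interior vertex\<close>

lemma length_delete_nth: "i < length xs \<Longrightarrow> length (delete_nth i xs) = length xs - 1"
  by (auto simp: delete_nth_def)

lemma nth_delete_nth:
  assumes "i < length xs" "j < length xs - 1"
  shows "delete_nth i xs ! j = (if j < i then xs ! j else xs ! Suc j)"
  using assms by (auto simp: delete_nth_def nth_append min_def)

lemma set_delete_nth_subset: "set (delete_nth i xs) \<subseteq> set xs"
  by (auto simp: delete_nth_def dest: in_set_takeD in_set_dropD)

lemma has_cycle_3I:
  assumes "{a, b} \<in> E" "{b, c} \<in> E" "{c, a} \<in> E" "distinct [a, b, c]"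
  shows "has_cycle E 3"
  unfolding has_cycle_def
proof (intro exI conjI)
  show "\<forall>i<3. {[a, b, c] ! i, [a, b, c] ! (Suc i mod 3)} \<in> E"
  proof (intro allI impI)
    fix i :: nat assume "i < 3"
    then consider "i = 0" | "i = 1" | "i = 2" by linarith
    then show "{[a, b, c] ! i, [a, b, c] ! (Suc i mod 3)} \<in> E"
      using assms by cases simp_all
  qed
qed (use assms in auto)

lemma has_cycle_4I:
  assumes "{a, b} \<in> E" "{b, c} \<in> E" "{c, d} \<in> E" "{d, a} \<in> E" "distinct [a, b, c, d]"
  shows "has_cycle E 4"
  unfolding has_cycle_def
proof (intro exI conjI)
  show "\<forall>i<4. {[a, b, c, d] ! i, [a, b, c, d] ! (Suc i mod 4)} \<in> E"
  proof (intro allI impI)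
    fix i :: nat assume "i < 4"
    then consider "i = 0" | "i = 1" | "i = 2" | "i = 3" by linarith
    then show "{[a, b, c, d] ! i, [a, b, c, d] ! (Suc i mod 4)} \<in> E"
      using assms by cases simp_all
  qed
qed (use assms in auto)

text \<open>If the two neighbours of the deleted vertex coincide, the new tuple repeats a vertex in
  consecutive places. If they differ, they are not adjacent, so the merged step has length 2 and the
  total length is preserved. Writing the interior index as \<open>Suc j\<close> avoids
  subtraction.\<close>

lemma delete_nth_mem_k_paths_iff:
  assumes G: "simple_graph V E" and no3: "\<not> has_cycle E 3"
    and xs: "xs \<in> walks V E k" and j: "Suc j < k"
  shows "delete_nth (Suc j) xs \<in> k_paths V E (k - 1) k \<longleftrightarrow> xs ! j \<noteq> xs ! Suc (Suc j)"
proof -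
  let ?y = "delete_nth (Suc j) xs"
  have len: "length xs = Suc k" and sub: "set xs \<subseteq> V"
    and edge: "\<And>i. i < k \<Longrightarrow> {xs ! i, xs ! Suc i} \<in> E"
    using xs by (auto simp: walks_def)
  have nth: "?y ! m = (if m \<le> j then xs ! m else xs ! Suc m)" if "m < k" for m
    using nth_delete_nth[of "Suc j" xs m] len that j by (auto simp: less_Suc_eq_le)
  have leny: "length ?y = Suc (k - 1)"
    using len j by (simp add: length_delete_nth)
  show ?thesis
  proof
    assume "?y \<in> k_paths V E (k - 1) k"
    then have "?y ! j \<noteq> ?y ! Suc j"
      using j by (auto simp: k_paths_def k_path_def)
    then show "xs ! j \<noteq> xs ! Suc (Suc j)"
      using nth[of j] nth[of "Suc j"] j by auto
  next
    assume ne: "xs ! j \<noteq> xs ! Suc (Suc j)"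
    have e: "{xs ! j, xs ! Suc j} \<in> E" "{xs ! Suc j, xs ! Suc (Suc j)} \<in> E"
      using edge j by auto
    \<comment> \<open>This edge would close a triangle with the two edges at the deleted
      vertex.\<close>
    have "{xs ! j, xs ! Suc (Suc j)} \<notin> E"
      using has_cycle_3I[OF e] e ne no3 simple_graph_edge(1)[OF G e(1)]
        simple_graph_edge(1)[OF G e(2)] by (auto simp: insert_commute)
    then have 2: "graph_dist V E (xs ! j) (xs ! Suc (Suc j)) = 2"
      by (intro graph_dist_eq_2[OF G e ne])
    \<comment> \<open>Step \<open>j\<close> is the merged one; every other step is an edge inherited
      from \<open>xs\<close>. Hence the \<open>k - 1\<close> steps have total length
      \<open>(k - 1) + 1\<close>.\<close>
    have d: "graph_dist V E (?y ! m) (?y ! Suc m) = 1 + (if j = m then 1 else 0)"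
      if "m < k - 1" for m
    proof (cases "j = m")
      case True
      with 2 nth[of m] nth[of "Suc m"] that show ?thesis by auto
    next
      case False
      then have "{?y ! m, ?y ! Suc m} \<in> E"
        using nth[of m] nth[of "Suc m"] edge[of m] edge[of "Suc m"] that by auto
      with False show ?thesis
        by (simp add: graph_dist_eq_1_iff[OF G])
    qed
    have neq: "?y ! m \<noteq> ?y ! Suc m" if "m < k - 1" for m
    proof (cases "j = m")
      case True
      with ne nth[of m] nth[of "Suc m"] that show ?thesis by auto
    next
      case False
      then have "{?y ! m, ?y ! Suc m} \<in> E"
        using nth[of m] nth[of "Suc m"] edge[of m] edge[of "Suc m"] that by auto
      then show ?thesis by (rule simple_graph_edge(1)[OF G])
    qed
    have "k_path V E (k - 1) ?y"
      unfolding k_path_def using leny neq d sub set_delete_nth_subset[of "Suc j" xs]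
      by (auto simp: one_enat_def)
    moreover have "k_path_length V E ?y = (\<Sum>m<k - 1. 1 + (if j = m then 1 else 0))"
      unfolding k_path_length_def using leny d by (intro sum.cong) auto
    then have "k_path_length V E ?y = enat (k - 1) + 1"
      using j by (simp add: sum.distrib of_nat_eq_enat)
    ultimately show "?y \<in> k_paths V E (k - 1) k"
      using j by (simp add: k_paths_def one_enat_def)
  qed
qed

text \<open>A non-zero face remembers both the walk and the deleted position: its only step that is
  not an edge marks the position, and two different vertices filling that gap would give a
  4-cycle.\<close>

lemma delete_nth_walk_inj:
  assumes G: "simple_graph V E" and no4: "\<not> has_cycle E 4"
    and xs: "xs \<in> walks V E k" "Suc i < k" and ys: "ys \<in> walks V E k" "Suc j < k"
    and eq: "delete_nth (Suc i) xs = delete_nth (Suc j) ys"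
    and path: "delete_nth (Suc i) xs \<in> k_paths V E (k - 1) k"
  shows "i = j \<and> xs = ys"
proof -
  let ?y = "delete_nth (Suc i) xs"
  have len: "length xs = Suc k" "length ys = Suc k"
    and edge: "\<And>m. m < k \<Longrightarrow> {xs ! m, xs ! Suc m} \<in> E" "\<And>m. m < k \<Longrightarrow> {ys ! m, ys ! Suc m} \<in> E"
    using xs ys by (auto simp: walks_def)
  have nthx: "?y ! m = (if m \<le> i then xs ! m else xs ! Suc m)" if "m < k" for m
    using nth_delete_nth[of "Suc i" xs m] len that xs(2) by (auto simp: less_Suc_eq_le)
  have nthy: "?y ! m = (if m \<le> j then ys ! m else ys ! Suc m)" if "m < k" for m
    using nth_delete_nth[of "Suc j" ys m] len that ys(2) eq by (auto simp: less_Suc_eq_le)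
  have leny: "length ?y = Suc (k - 1)"
    using len xs by (simp add: length_delete_nth)
  have ij: "i = j"
  proof (rule ccontr)
    assume "i \<noteq> j"
    \<comment> \<open>A step other than \<open>i\<close> is an edge of \<open>xs\<close>; step
      \<open>i\<close> is an edge of \<open>ys\<close>, since it differs from \<open>j\<close>. The
      face would then be a walk of length \<open>k - 1\<close>, whereas its length is
      \<open>k\<close>.\<close>
    then have "{?y ! m, ?y ! Suc m} \<in> E" if "m < k - 1" for m
      using nthx[of m] nthx[of "Suc m"] nthy[of m] nthy[of "Suc m"] that
        edge(1)[of m] edge(1)[of "Suc m"] edge(2)[of m] edge(2)[of "Suc m"]
      by (cases "m = i") auto
    then have "?y \<in> walks V E (k - 1)"
      using path leny by (auto simp: walks_def k_paths_def k_path_def)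
    then have "?y \<in> k_paths V E (k - 1) (k - 1)"
      by (simp add: k_paths_diagonal[OF G])
    with path xs(2) show False
      by (auto simp: k_paths_def)
  qed
  have other: "xs ! m = ys ! m" if "m \<noteq> Suc i" "m < Suc k" for m
  proof (cases "m \<le> i")
    case True
    with nthx[of m] nthy[of m] ij xs(2) show ?thesis by auto
  next
    case False
    \<comment> \<open>Beyond the deleted position, entry \<open>m\<close> of either walk is entry
      \<open>m - 1\<close> of the common face.\<close>
    with that obtain m' where "m = Suc m'" "i < m'"
      by (cases m) auto
    with nthx[of m'] nthy[of m'] ij that show ?thesis by auto
  qed
  let ?a = "xs ! i" and ?b = "xs ! Suc i" and ?c = "xs ! Suc (Suc i)" and ?d = "ys ! Suc i"
  have "?y ! i \<noteq> ?y ! Suc i"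
    using path xs(2) by (simp add: k_paths_def k_path_def)
  then have "?a \<noteq> ?c"
    using nthx[of i] nthx[of "Suc i"] xs(2) by simp
  moreover have e: "{?a, ?b} \<in> E" "{?b, ?c} \<in> E" "{?c, ?d} \<in> E" "{?d, ?a} \<in> E"
    using edge(1)[of i] edge(1)[of "Suc i"] edge(2)[of i] edge(2)[of "Suc i"] xs(2)
      other[of i] other[of "Suc (Suc i)"] by (auto simp: insert_commute)
  \<comment> \<open>Otherwise the four vertices are distinct: \<open>?a\<close> and
    \<open>?c\<close> are consecutive in the face, and the remaining pairs, apart from
    \<open>?b\<close> and \<open>?d\<close>, are joined by edges. They would form a 4-cycle.\<close>
  ultimately have "?b = ?d"
    using has_cycle_4I[OF e] no4 e[THEN simple_graph_edge(1)[OF G]] by auto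
  with other have "xs ! m = ys ! m" if "m < Suc k" for m
    using that by (cases "m = Suc i") auto
  with len ij show ?thesis
    by (auto intro: nth_equalityI)
qed

section \<open>The kernel of the differential\<close>

text \<open>In a graph without triangles the condition says that every interior deletion gives the
  zero face.\<close>

definition faceless_walks :: "'a set \<Rightarrow> 'a set set \<Rightarrow> nat \<Rightarrow> 'a list set" where
  "faceless_walks V E k = {xs \<in> walks V E k. \<forall>j. Suc j < k \<longrightarrow> xs ! j = xs ! Suc (Suc j)}"

lemma lookup_frag_extend:
  "Poly_Mapping.lookup (frag_extend f c) y =
     (\<Sum>x\<in>Poly_Mapping.keys c. Poly_Mapping.lookup c x * Poly_Mapping.lookup (f x) y)"
  by (simp add: frag_extend_def lookup_sum)

text \<open>A walk in the support of \<open>c\<close> with a non-zero face leaves a non-zero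
  coefficient at that face, because no other walk or position produces it and nothing can
  cancel.\<close>

lemma MC_diff_eq_0_iff:
  assumes G: "simple_graph V E" and no3: "\<not> has_cycle E 3" and no4: "\<not> has_cycle E 4"
    and c: "Poly_Mapping.keys c \<subseteq> walks V E k"
  shows "MC_diff V E k k c = 0 \<longleftrightarrow> Poly_Mapping.keys c \<subseteq> faceless_walks V E k"
proof
  assume keys: "Poly_Mapping.keys c \<subseteq> faceless_walks V E k"
  have "MC_face V E k k i xs = 0" if "xs \<in> Poly_Mapping.keys c" "i \<in> {1..k - 1}" for xs i
  proof -
    from that obtain j where "i = Suc j" "Suc j < k"
      by (cases i) auto
    moreover have "xs \<in> faceless_walks V E k"
      using keys that by blast
    ultimately show ?thesis
      using delete_nth_mem_k_paths_iff[OF G no3, of xs k j]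
      by (auto simp: MC_face_def faceless_walks_def)
  qed
  then show "MC_diff V E k k c = 0"
    unfolding MC_diff_def by (intro frag_extend_eq_0 sum.neutral) simp
next
  assume 0: "MC_diff V E k k c = 0"
  show "Poly_Mapping.keys c \<subseteq> faceless_walks V E k"
  proof (rule ccontr)
    assume "\<not> ?thesis"
    then obtain xs j where xs: "xs \<in> Poly_Mapping.keys c" and j: "Suc j < k"
      and ne: "xs ! j \<noteq> xs ! Suc (Suc j)"
      using c by (auto simp: faceless_walks_def)
    let ?y = "delete_nth (Suc j) xs"
    have xsw: "xs \<in> walks V E k"
      using xs c by blast
    have y: "?y \<in> k_paths V E (k - 1) k"
      using delete_nth_mem_k_paths_iff[OF G no3 xsw j] ne by simp
    \<comment> \<open>By injectivity of non-zero faces, \<open>?y\<close> arises only from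
      \<open>xs\<close> at position \<open>Suc j\<close>. Both sums in the differential therefore
      collapse to one term, the coefficient of \<open>xs\<close> up to sign.\<close>
    have face: "Poly_Mapping.lookup (MC_face V E k k i zs) ?y = (if zs = xs \<and> i = Suc j then 1 else 0)"
      if "zs \<in> walks V E k" "i \<in> {1..k - 1}" for zs i
    proof -
      from that obtain m where m: "i = Suc m" "Suc m < k"
        by (cases i) auto
      have "i = Suc j \<and> zs = xs" if "delete_nth i zs = ?y"
        using delete_nth_walk_inj[OF G no4 xsw j \<open>zs \<in> walks V E k\<close> m(2)] that m y by simp
      then show ?thesis
        using y by (auto simp: MC_face_def)
    qed
    have "Poly_Mapping.lookup (\<Sum>i = 1..k - 1. frag_cmul ((- 1) ^ i) (MC_face V E k k i zs)) ?y =
        (if zs = xs then (- 1) ^ Suc j else 0)" if "zs \<in> Poly_Mapping.keys c" for zs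
    proof -
      have "zs \<in> walks V E k" using that c by blast
      then have "Poly_Mapping.lookup (\<Sum>i = 1..k - 1. frag_cmul ((- 1) ^ i) (MC_face V E k k i zs)) ?y =
          (\<Sum>i = 1..k - 1. if i = Suc j then (if zs = xs then (- 1) ^ i else 0) else 0)"
        unfolding lookup_sum by (intro sum.cong) (auto simp: face)
      also have "\<dots> = (if zs = xs then (- 1) ^ Suc j else 0)"
        using j by (subst sum.delta) auto
      finally show ?thesis .
    qed
    then have "Poly_Mapping.lookup (MC_diff V E k k c) ?y =
        (\<Sum>zs\<in>Poly_Mapping.keys c. if zs = xs then Poly_Mapping.lookup c xs * (- 1) ^ Suc j else 0)"
      unfolding MC_diff_def lookup_frag_extend by (intro sum.cong) auto
    also have "\<dots> = Poly_Mapping.lookup c xs * (- 1) ^ Suc j"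
      using xs by (subst sum.delta) auto
    finally show False
      using 0 xs by (simp add: in_keys_iff)
  qed
qed

section \<open>The diagonal groups as free Abelian groups\<close>

lemma subgroup_generated_free_Abelian_group:
  assumes "T \<subseteq> S"
  shows "subgroup_generated (free_Abelian_group S) (carrier (free_Abelian_group T)) =
    free_Abelian_group T"
proof -
  have "subgroup (carrier (free_Abelian_group T)) (free_Abelian_group S)"
  proof (rule group.subgroupI)
    show "carrier (free_Abelian_group T) \<noteq> {}"
      by (metis empty_iff one_free_Abelian_group group.is_monoid group_free_Abelian_group monoid.one_closed)
    fix a b
    assume a: "a \<in> carrier (free_Abelian_group T)"
    then show "inv\<^bsub>free_Abelian_group S\<^esub> a \<in> carrier (free_Abelian_group T)"
      using assms by (subst inv_free_Abelian_group) auto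
    assume "b \<in> carrier (free_Abelian_group T)"
    with a show "a \<otimes>\<^bsub>free_Abelian_group S\<^esub> b \<in> carrier (free_Abelian_group T)"
      using keys_add[of a b] by auto
  qed (use assms in auto)
  \<comment> \<open>The basis enters the record \<open>free_Abelian_group\<close> only through its
    carrier, so the two groups are equal and not merely isomorphic.\<close>
  from subgroup.carrier_subgroup_generated_subgroup[OF this] show ?thesis
    by (simp add: subgroup_generated_def free_Abelian_group_def)
qed

lemma MH_diagonal_iso:
  assumes G: "simple_graph V E" and no3: "\<not> has_cycle E 3" and no4: "\<not> has_cycle E 4"
  shows "group (MH V E k k)" "MH V E k k \<cong> free_Abelian_group (faceless_walks V E k)"
proof -
  have sub: "faceless_walks V E k \<subseteq> walks V E k"
    by (auto simp: faceless_walks_def)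
  \<comment> \<open>The neutral element of the target is \<open>0\<close> for any basis. This covers
    \<open>k = 0\<close> as well: there the differential is an empty sum and every walk is
    faceless.\<close>
  have "kernel (MC V E k k) (MC V E (k - 1) k) (MC_diff V E k k) =
      carrier (free_Abelian_group (faceless_walks V E k))"
  proof (rule Set.set_eqI)
    fix c
    show "c \<in> kernel (MC V E k k) (MC V E (k - 1) k) (MC_diff V E k k) \<longleftrightarrow>
        c \<in> carrier (free_Abelian_group (faceless_walks V E k))"
      using MC_diff_eq_0_iff[OF assms, of c k] subset_trans[OF _ sub, of "Poly_Mapping.keys c"]
      unfolding kernel_def MC_def k_paths_diagonal[OF G] by simp blast
  qed
  then have "subgroup_generated (MC V E k k)
      (kernel (MC V E k k) (MC V E (k - 1) k) (MC_diff V E k k)) =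
      free_Abelian_group (faceless_walks V E k)"
    unfolding MC_def k_paths_diagonal[OF G]
    by (simp add: subgroup_generated_free_Abelian_group[OF sub])
  moreover have "carrier (MC V E (Suc k) k) = {0}"
    by (auto simp: MC_def k_paths_above_diagonal)
  then have "MC_diff V E (Suc k) k ` carrier (MC V E (Suc k) k) = {0}"
    by (simp add: MC_diff_def)
  ultimately have "MH V E k k = free_Abelian_group (faceless_walks V E k) Mod
      {\<one>\<^bsub>free_Abelian_group (faceless_walks V E k)\<^esub>}"
    by (simp add: MH_def)
  then show "MH V E k k \<cong> free_Abelian_group (faceless_walks V E k)" "group (MH V E k k)"
    using group.trivial_factor_iso[OF group_free_Abelian_group, of "faceless_walks V E k"]
      normal.factorgroup_is_group[OF group.one_is_normal[OF group_free_Abelian_group]]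
    by (auto simp: is_iso_def)
qed

section \<open>Torsion and rank\<close>

text \<open>Powers are integer multiples taken coefficientwise, and \<int> has no zero
  divisors.\<close>

lemma torsion_free_free_Abelian_group: "torsion_free_group (free_Abelian_group S)"
  by (auto simp: torsion_free_group_def)

lemma torsion_free_group_iso:
  assumes "H \<cong> K" "group H" "group K" "torsion_free_group K"
  shows "torsion_free_group H"
proof -
  obtain h where h: "h \<in> iso H K"
    using assms(1) by (auto simp: is_iso_def)
  interpret group_hom H K h
    using h assms by (simp add: group_hom_def group_hom_axioms_def iso_def)
  have inj: "inj_on h (carrier H)"
    using h by (simp add: iso_def bij_betw_def)
  show ?thesis
    unfolding torsion_free_group_def
  proof (intro ballI allI impI)
    fix x and n :: nat
    assume x: "x \<in> carrier H" and n: "n > 0" and eq: "x [^]\<^bsub>H\<^esub> n = \<one>\<^bsub>H\<^esub>"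
    have "h x [^]\<^bsub>K\<^esub> n = \<one>\<^bsub>K\<^esub>"
      using hom_nat_pow[OF x, of n] eq by simp
    then have "h x = \<one>\<^bsub>K\<^esub>"
      using assms(4) x n by (auto simp: torsion_free_group_def)
    then show "x = \<one>\<^bsub>H\<^esub>"
      using inj x by (metis hom_one inj_onD G.one_closed)
  qed
qed

text \<open>Over the finite index set \<open>{..<n}\<close> finite support is automatic, so the
  direct product coincides with the direct sum, which is free on its index set.\<close>

lemma integer_power_group_iso:
  "integer_power_group n \<cong> free_Abelian_group {..<n}"
proof -
  have "carrier (sum_group {..<n} (\<lambda>_. integer_group)) =
      carrier (product_group {..<n} (\<lambda>_. integer_group))"
    by (subst carrier_sum_group) auto
  then have "sum_group {..<n} (\<lambda>_. integer_group) = integer_power_group n"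
    unfolding integer_power_group_def sum_group_def
    by (simp add: subgroup_generated_def product_group_def)
  then show ?thesis
    using isomorphic_sum_integer_group by metis
qed

lemma free_Abelian_group_iso_integer_power_group:
  assumes "finite S"
  shows "free_Abelian_group S \<cong> integer_power_group (card S)"
proof -
  have "S \<approx> {..<card S}"
    using assms by (simp add: eqpoll_iff_card)
  then have "free_Abelian_group S \<cong> free_Abelian_group {..<card S}"
    by (simp add: isomorphic_free_Abelian_groups)
  moreover have "free_Abelian_group {..<card S} \<cong> integer_power_group (card S)"
    using integer_power_group_iso
    by (rule group.iso_sym[rotated]) (simp add: integer_power_group_def product_group)
  ultimately show ?thesis
    by (rule iso_trans)
qed

section \<open>Counting the faceless walks\<close>

lemma faceless_walks_0: "faceless_walks V E 0 = (\<lambda>v. [v]) ` V"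
  by (auto simp: faceless_walks_def walks_def length_Suc_conv)

definition alternating_walk :: "nat \<Rightarrow> 'a \<times> 'a \<Rightarrow> 'a list" where
  "alternating_walk k = (\<lambda>(u, v). map (\<lambda>i. if even i then u else v) [0..<Suc k])"

text \<open>A faceless walk has period two, so its first two entries, an oriented edge, determine
  it. The assumption \<open>k > 0\<close> ensures that both entries exist.\<close>

lemma bij_betw_alternating_walk:
  assumes G: "simple_graph V E" and k: "k > 0"
  shows "bij_betw (alternating_walk k) {(u, v). {u, v} \<in> E} (faceless_walks V E k)"
proof (rule bij_betwI')
  fix p q :: "'a \<times> 'a"
  have "alternating_walk k p ! 0 = fst p \<and> alternating_walk k p ! 1 = snd p" for p :: "'a \<times> 'a"
    using k by (auto simp: alternating_walk_def nth_append split: prod.split)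
  then show "alternating_walk k p = alternating_walk k q \<longleftrightarrow> p = q"
    by (metis prod_eq_iff)
next
  fix p assume "p \<in> {(u, v). {u, v} \<in> E}"
  then obtain u v where p: "p = (u, v)" and e: "{u, v} \<in> E" by blast
  have "alternating_walk k p ! i = (if even i then u else v)" if "i < Suc k" for i
    using that by (simp add: alternating_walk_def p del: upt_Suc)
  moreover have "set (alternating_walk k p) \<subseteq> V" "length (alternating_walk k p) = Suc k"
    using simple_graph_edge[OF G e] by (auto simp: alternating_walk_def p)
  ultimately show "alternating_walk k p \<in> faceless_walks V E k"
    using e by (auto simp: faceless_walks_def walks_def insert_commute)
next
  fix xs assume "xs \<in> faceless_walks V E k"
  then have len: "length xs = Suc k" and edge: "{xs ! 0, xs ! 1} \<in> E"
    and alt: "\<And>j. Suc j < k \<Longrightarrow> xs ! j = xs ! Suc (Suc j)"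
    using k by (auto simp: faceless_walks_def walks_def)
  \<comment> \<open>The induction advances by two positions, matching the period given by
    \<open>alt\<close>.\<close>
  have nth: "i < Suc k \<Longrightarrow> xs ! i = (if even i then xs ! 0 else xs ! 1)" for i
  proof (induction i rule: induct_nat_012)
    case (ge2 n)
    then show ?case using alt[of n] by auto
  qed auto
  have "xs = alternating_walk k (xs ! 0, xs ! 1)"
  proof (rule nth_equalityI)
    fix i assume "i < length xs"
    with len have "i < Suc k" by simp
    from nth[OF this] \<open>i < Suc k\<close> show "xs ! i = alternating_walk k (xs ! 0, xs ! 1) ! i"
      by (simp add: alternating_walk_def del: upt_Suc)
  qed (simp add: alternating_walk_def len)
  with edge show "\<exists>p\<in>{(u, v). {u, v} \<in> E}. xs = alternating_walk k p"
    by blast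
qed

text \<open>Each edge has two distinct end points and hence exactly two orientations; the sets of
  orientations of different edges are disjoint.\<close>

lemma card_oriented_edges:
  assumes "simple_graph V E"
  shows "finite {(u, v). {u, v} \<in> E}" "card {(u, v). {u, v} \<in> E} = 2 * card E"
proof -
  let ?O = "\<lambda>e. {(u, v). {u, v} = e}"
  have fin: "finite E"
    using assms by (auto simp: simple_graph_def intro: finite_subset[of E "Pow V"])
  have two: "finite (?O e)" "card (?O e) = 2" if e: "e \<in> E" for e
  proof -
    obtain a b where "e = {a, b}" "a \<noteq> b"
      using assms e by (auto simp: simple_graph_def card_2_iff)
    then have "?O e = {(a, b), (b, a)}"
      by (auto simp: doubleton_eq_iff)
    with \<open>a \<noteq> b\<close> show "finite (?O e)" "card (?O e) = 2" by auto
  qed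
  have un: "{(u, v). {u, v} \<in> E} = (\<Union>e\<in>E. ?O e)" by auto
  show "finite {(u, v). {u, v} \<in> E}"
    unfolding un using fin two by blast
  show "card {(u, v). {u, v} \<in> E} = 2 * card E"
    unfolding un using fin two by (subst card_UN_disjoint) auto
qed

theorem theorem4p3:
  fixes V :: "'a set" and E :: "'a set set"
  assumes "simple_graph V E"
    and "\<not> has_cycle E 3"
    and "\<not> has_cycle E 4"
  shows "(\<forall>k. torsion_free_group (MH V E k k)) \<and>
    MH V E 0 0 \<cong> integer_power_group (card V) \<and>
    (\<forall>k>0. MH V E k k \<cong> integer_power_group (2 * card E))"
proof (intro conjI allI impI)
  note iso = MH_diagonal_iso(2)[OF assms]
  fix k
  show "torsion_free_group (MH V E k k)"
    using iso MH_diagonal_iso(1)[OF assms] group_free_Abelian_group torsion_free_free_Abelian_group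
    by (rule torsion_free_group_iso)
  show "MH V E 0 0 \<cong> integer_power_group (card V)"
  proof -
    have "finite V"
      using assms by (simp add: simple_graph_def)
    moreover have "card ((\<lambda>v. [v]) ` V) = card V"
      by (intro card_image) (simp add: inj_on_def)
    ultimately have "free_Abelian_group (faceless_walks V E 0) \<cong> integer_power_group (card V)"
      using free_Abelian_group_iso_integer_power_group[of "(\<lambda>v. [v]) ` V"]
      by (simp add: faceless_walks_0)
    with iso show ?thesis by (rule iso_trans)
  qed
  show "MH V E k k \<cong> integer_power_group (2 * card E)" if "k > 0"
  proof -
    note bij = bij_betw_alternating_walk[OF assms(1) that]
    have "finite (faceless_walks V E k)" "card (faceless_walks V E k) = 2 * card E"
      using bij_betw_finite[OF bij] bij_betw_same_card[OF bij] card_oriented_edges[OF assms(1)]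
      by auto
    then have "free_Abelian_group (faceless_walks V E k) \<cong> integer_power_group (2 * card E)"
      using free_Abelian_group_iso_integer_power_group by metis
    with iso show ?thesis by (rule iso_trans)
  qed
qed

end
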